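(* Let $A,B,H,K$ be logically independent events. Then generalized two-premise centering is not p-valid for $|_C,|_{dF},|_F,|_K,|_L$: $$\{A|H,\ B|K\}\not\Rightarrow_p (B|K)|_i(A|H),\qquad i\in\{C,dF,F,K,L\}.$$
   Context: Events are two-valued entities identified with their indicators (values $1/0$); $\emptyset$ is the impossible event, $AB=A\wedge B$, $\overline{A}$ is the negation. Four events are logically independent if all $16$ conjunctions obtained by taking each event or its negation are different from $\emptyset$. For $H\neq\emptyset$ the conditional event $E|H$ is true if $EH$ is true, false if $\overline{E}H$ is true, void if $\overline{H}$ is true. Once $P(E|H)=p$ is assessed, $E|H$ is also the random quantity $EH+p\overline{H}$; numerically $\overline{A}|H=1-A|H$. Subscripts such as $K$ on operations are only names, unrelated to the events. Iterated conditionals that are conditional events: $(B|K)|_{C}(A|H)=B|(K\wedge(\overline{H}\vee A))$; $(B|K)|_{dF}(A|H)=B|(AHK)$; $(B|K)|_{F}(A|H)=AHBK|(AHBK\vee AH\overline{B}K\vee\overline{H}\,\overline{B}K)$. Conjunctions (conditional events): $(A|H)\wedge_K(B|K)=AHBK|(HK\vee\overline{A}H\vee\overline{B}K)$; $(A|H)\wedge_L(B|K)=AHBK|(AHBK\vee\overline{A}H\vee\overline{B}K\vee\overline{H}\,\overline{K})$. For $i\in\{K,L\}$, $(B|K)|_i(A|H)$ is the random quantity $(A|H)\wedge_i(B|K)+\mu_i(\overline{A}|H)$, where $\mu_i=\mathbb{P}[(B|K)|_i(A|H)]$ is its assessed prevision (the amount paid to receive it). Coherence: an assessment of real values $m_j$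 on a finite family of such objects $X_j$ is coherent iff for every nonempty subfamily $J$ and all reals $s_j$, the random gain $\sum_{j\in J}s_j(X_j-m_j)$, restricted to the cases where at least one of the bets in $J$ is not called off, has minimum $\le 0$ and maximum $\ge 0$. A bet on a conditional event is called off when it is void; a bet on an iterated conditional with $i\in\{K,L\}$ is called off in the cases where one receives back the paid amount $\mu_i$ whatever it is (taking into account the relation $z_i=x\mu_i$, with $x=P(A|H)$ and $z_i=P[(A|H)\wedge_i(B|K)]$, required by linearity of coherent previsions). For a family containing such an iterated conditional, an assessment is coherent iff it extends to a coherent assessment on the family enlarged with $A|H$, $B|K$ and $(A|H)\wedge_i(B|K)$. A finite family $\mathcal{F}$ of (conditional) random quantities with values in a finite subset of $[0,1]$ is p-consistent if the assessment $(1,\dots,1)$ on $\mathcal{F}$ is coherent. A p-consistent $\mathcal{F}=\{X_1,\dots,X_n\}$ p-entails $X$ (written $\mathcal{F}\Rightarrow_p X$) iff for every coherent assessment $(\mu_1,\dots,\mu_n,z)$ on $\mathcal{F}\cup\{X\}$: $\mu_1=\dots=\mu_n=1$ implies $z=1$. *)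

theory Defs
  imports Complex_Main "HOL-Library.Indicator_Function"
begin

text \<open>Events are sets of possible worlds; the impossible event is the empty set.\<close>

definition logically_independent :: "'w set \<Rightarrow> 'w set \<Rightarrow> 'w set \<Rightarrow> 'w set \<Rightarrow> bool" where
  "logically_independent A B H K \<longleftrightarrow>
     (\<forall>A'\<in>{A, - A}. \<forall>B'\<in>{B, - B}. \<forall>H'\<in>{H, - H}. \<forall>K'\<in>{K, - K}.
        A' \<inter> B' \<inter> H' \<inter> K' \<noteq> {})"

text \<open>\<open>E \<parallel> H\<close> is the conditional event \<open>E|H\<close>. It is meaningful only for \<open>H \<noteq> {}\<close>, which
  the type does not enforce; under logical independence all conditioning events below are nonempty.\<close>

datatype 'w cond_event = Given "'w set" "'w set"  (infix "\<parallel>" 60)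

text \<open>The random quantity \<open>EH + p \<cdot> not H\<close> that \<open>E|H\<close> becomes once \<open>P(E|H) = p\<close> is assessed.\<close>

fun ce_value :: "'w cond_event \<Rightarrow> real \<Rightarrow> 'w \<Rightarrow> real" where
  "ce_value (E \<parallel> H) p w = indicator (E \<inter> H) w + p * indicator (- H) w"

fun ce_void :: "'w cond_event \<Rightarrow> 'w \<Rightarrow> bool" where
  "ce_void (E \<parallel> H) w \<longleftrightarrow> w \<in> - H"

datatype conj_kind = Kleene | Lukasiewicz

fun ce_conj :: "conj_kind \<Rightarrow> 'w cond_event \<Rightarrow> 'w cond_event \<Rightarrow> 'w cond_event" where
  "ce_conj Kleene (A \<parallel> H) (B \<parallel> K) =
     (A \<inter> H \<inter> B \<inter> K) \<parallel> ((H \<inter> K) \<union> (- A \<inter> H) \<union> (- B \<inter> K))"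
| "ce_conj Lukasiewicz (A \<parallel> H) (B \<parallel> K) =
     (A \<inter> H \<inter> B \<inter> K) \<parallel> ((A \<inter> H \<inter> B \<inter> K) \<union> (- A \<inter> H) \<union> (- B \<inter> K) \<union> (- H \<inter> - K))"

text \<open>Iterated conditionals that are conditional events. The first argument is the consequent
  \<open>B|K\<close>, the second the antecedent \<open>A|H\<close>.\<close>

fun iter_C :: "'w cond_event \<Rightarrow> 'w cond_event \<Rightarrow> 'w cond_event" where
  "iter_C (B \<parallel> K) (A \<parallel> H) = B \<parallel> (K \<inter> (- H \<union> A))"

fun iter_dF :: "'w cond_event \<Rightarrow> 'w cond_event \<Rightarrow> 'w cond_event" where
  "iter_dF (B \<parallel> K) (A \<parallel> H) = B \<parallel> (A \<inter> H \<inter> K)"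

fun iter_F :: "'w cond_event \<Rightarrow> 'w cond_event \<Rightarrow> 'w cond_event" where
  "iter_F (B \<parallel> K) (A \<parallel> H) =
     (A \<inter> H \<inter> B \<inter> K) \<parallel> ((A \<inter> H \<inter> B \<inter> K) \<union> (A \<inter> H \<inter> - B \<inter> K) \<union> (- H \<inter> - B \<inter> K))"

text \<open>The objects on which bets are made. \<open>Iter i Y X\<close> stands for \<open>Y |\<^sub>i X\<close> with \<open>i\<close> one of
  \<open>K\<close>, \<open>L\<close>; it is not a conditional event, and its values depend on an assessment.\<close>

datatype 'w quantity =
    Cond "'w cond_event"
  | Iter conj_kind "'w cond_event" "'w cond_event"

text \<open>The value of \<open>X \<and>\<^sub>i Y + \<mu> \<cdot> (not X)\<close>, where \<open>x\<close>, \<open>z\<close>, \<open>\<mu>\<close> are the previsions of \<open>X\<close>,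
  \<open>X \<and>\<^sub>i Y\<close>, \<open>Y |\<^sub>i X\<close>, and the negation of \<open>X\<close> is numerically \<open>1 - X\<close>.\<close>

definition iter_value ::
  "conj_kind \<Rightarrow> 'w cond_event \<Rightarrow> 'w cond_event \<Rightarrow> real \<Rightarrow> real \<Rightarrow> real \<Rightarrow> 'w \<Rightarrow> real" where
  "iter_value i Y X x z \<mu> w = ce_value (ce_conj i X Y) z w + \<mu> * (1 - ce_value X x w)"

fun quantity_value :: "('w quantity \<Rightarrow> real) \<Rightarrow> 'w quantity \<Rightarrow> 'w \<Rightarrow> real" where
  "quantity_value m (Cond X) w = ce_value X (m (Cond X)) w"
| "quantity_value m (Iter i Y X) w =
     iter_value i Y X (m (Cond X)) (m (Cond (ce_conj i X Y))) (m (Iter i Y X)) w"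

text \<open>A bet on \<open>Y |\<^sub>i X\<close> is called off where the amount received equals the amount paid, whatever
  the latter is; here \<open>x\<close> is the assessed \<open>P(X)\<close> and \<open>z\<close> varies with the paid amount as \<open>z = x \<mu>\<close>.\<close>

fun called_off :: "('w quantity \<Rightarrow> real) \<Rightarrow> 'w quantity \<Rightarrow> 'w \<Rightarrow> bool" where
  "called_off m (Cond X) w \<longleftrightarrow> ce_void X w"
| "called_off m (Iter i Y X) w \<longleftrightarrow>
     (\<forall>\<mu>. iter_value i Y X (m (Cond X)) (m (Cond X) * \<mu>) \<mu> w = \<mu>)"

definition gain ::
  "('w quantity \<Rightarrow> real) \<Rightarrow> 'w quantity set \<Rightarrow> ('w quantity \<Rightarrow> real) \<Rightarrow> 'w \<Rightarrow> real" where
  "gain m J s w = (\<Sum>X\<in>J. s X * (quantity_value m X w - m X))"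

definition active :: "('w quantity \<Rightarrow> real) \<Rightarrow> 'w quantity set \<Rightarrow> 'w set" where
  "active m J = {w. \<exists>X\<in>J. \<not> called_off m X w}"

text \<open>For finite \<open>J\<close> the gain takes only finitely many values, also when there are infinitely many
  worlds, so \<open>Min\<close> and \<open>Max\<close> are the genuine minimum and maximum.\<close>

definition betting_coherent :: "'w quantity set \<Rightarrow> ('w quantity \<Rightarrow> real) \<Rightarrow> bool" where
  "betting_coherent F m \<longleftrightarrow> finite F \<and>
     (\<forall>J s. J \<subseteq> F \<and> J \<noteq> {} \<longrightarrow>
        Min (gain m J s ` active m J) \<le> 0 \<and> 0 \<le> Max (gain m J s ` active m J))"

fun components :: "'w quantity \<Rightarrow> 'w quantity set" where
  "components (Cond X) = {}"
| "components (Iter i Y X) = {Cond X, Cond Y, Cond (ce_conj i X Y)}"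

text \<open>For families of conditional events nothing is added and this is \<open>betting_coherent\<close>. Only the
  values of \<open>m\<close> on \<open>F\<close> matter.\<close>

definition coherent :: "'w quantity set \<Rightarrow> ('w quantity \<Rightarrow> real) \<Rightarrow> bool" where
  "coherent F m \<longleftrightarrow>
     (\<exists>m'. (\<forall>X\<in>F. m' X = m X) \<and> betting_coherent (F \<union> (\<Union>X\<in>F. components X)) m')"

definition p_consistent :: "'w quantity set \<Rightarrow> bool" where
  "p_consistent F \<longleftrightarrow> coherent F (\<lambda>_. 1)"

text \<open>Intended for p-consistent \<open>F\<close>. P-consistency is not a conjunct of the definition, so that
  non-entailment always means that some coherent assessment has all premises \<open>1\<close> and \<open>m X \<noteq> 1\<close>.\<close>

definition p_entails :: "'w quantity set \<Rightarrow> 'w quantity \<Rightarrow> bool"  (infix "\<Rightarrow>\<^sub>p" 50) where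
  "F \<Rightarrow>\<^sub>p X \<longleftrightarrow> (\<forall>m. coherent (insert X F) m \<longrightarrow> (\<forall>Y\<in>F. m Y = 1) \<longrightarrow> m X = 1)"

end

theory Submission
  imports Defs
begin

text \<open>
  Why centering fails. Assess both premises \<open>A|H\<close> and \<open>B|K\<close> with \<open>1\<close> and everything else, that
  is, the iterated conditional and, for \<open>|\<^sub>K\<close> and \<open>|\<^sub>L\<close>, the conjunction as well, with \<open>0\<close>. One
  assessment serves all five notions, because the same three worlds witness its coherence:
  \<^item> in \<open>A H \<not>K\<close> the premise \<open>A|H\<close> is true and \<open>B|K\<close> is void;
  \<^item> in \<open>\<not>A H B K\<close> the premise \<open>A|H\<close> is lost, but \<open>B|K\<close> is true;
  \<^item> in \<open>A H \<not>B K\<close> the premise \<open>B|K\<close> is lost.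

  Every iterated conditional and every conjunction is void or pays \<open>0\<close> in each of these worlds,
  and in the third one it pays \<open>0\<close> without being called off. Hence a combination of bets is exactly
  fair in the first world if it includes \<open>A|H\<close>, in the second if it includes \<open>B|K\<close> but not \<open>A|H\<close>,
  and in the third if it includes neither; in each case one of the bets is in force. So no
  combination has a gain of constant sign (\<open>betting_coherentI\<close>, \<open>betting_coherent_layersI\<close>).
  Probabilistically, the assessment comes from a conditional probability in which \<open>A H K\<close> is null
  given \<open>H\<close> (because \<open>K\<close> is) and null given \<open>K\<close> (because \<open>\<not>A\<close> is certain there), so that
  certainty of both premises leaves \<open>B\<close> given \<open>A H K\<close> unconstrained.
\<close>

section \<open>Coherence from fair worlds\<close>

text \<open>Finiteness makes \<open>Min\<close> and \<open>Max\<close> in the definition of coherence meaningful.\<close>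

lemma finite_range_ce_value: "finite (range (ce_value X p))"
proof -
  obtain E H where "X = E \<parallel> H"
    by (cases X)
  then have "range (ce_value X p) \<subseteq> {0, 1, p}"
    by (auto simp: of_bool_def indicator_def split: if_splits)
  then show ?thesis
    using finite_subset by blast
qed

lemma finite_range_quantity_value: "finite (range (quantity_value m X))"
proof (cases X)
  case (Cond Y)
  then have "quantity_value m X = ce_value Y (m X)"
    by auto
  then show ?thesis
    by (simp add: finite_range_ce_value)
next
  case (Iter i Y X')
  let ?c = "ce_value (ce_conj i X' Y) (m (Cond (ce_conj i X' Y)))"
  let ?a = "ce_value X' (m (Cond X'))"
  have "range (quantity_value m X)
      \<subseteq> (\<lambda>(c, a). c + m X * (1 - a)) ` (range ?c \<times> range ?a)"
    using Iter by (auto simp: iter_value_def)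
  moreover have "finite (range ?c \<times> range ?a)"
    by (simp add: finite_range_ce_value)
  ultimately show ?thesis
    using finite_surj by blast
qed

lemma finite_range_gain:
  assumes "finite J"
  shows "finite (range (gain m J s))"
  using assms
proof (induction J rule: finite_induct)
  case empty
  then show ?case
    by (simp add: gain_def)
next
  case (insert X J)
  have "range (gain m (insert X J) s)
      \<subseteq> (\<lambda>(v, g). s X * (v - m X) + g) ` (range (quantity_value m X) \<times> range (gain m J s))"
    using insert.hyps by (auto simp: gain_def)
  moreover have "finite (range (quantity_value m X) \<times> range (gain m J s))"
    using insert.IH by (simp add: finite_range_quantity_value)
  ultimately show ?case
    using finite_surj by blast
qed

text \<open>A world that returns every stake exactly makes the gain \<open>0\<close> whatever the stakes, which puts
  \<open>0\<close> between minimum and maximum. Such a world replaces the separation argument that is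
  needed in general, where only a mixture of worlds is fair.\<close>

lemma betting_coherentI:
  assumes "finite F"
    and fair: "\<And>J. J \<subseteq> F \<Longrightarrow> J \<noteq> {} \<Longrightarrow>
      \<exists>w\<in>active m J. \<forall>X\<in>J. quantity_value m X w = m X"
  shows "betting_coherent F m"
  unfolding betting_coherent_def
proof (intro conjI allI impI)
  show "finite F"
    by fact
next
  fix J s
  assume J: "J \<subseteq> F \<and> J \<noteq> {}"
  then obtain w where w: "w \<in> active m J" "\<forall>X\<in>J. quantity_value m X w = m X"
    using fair by blast
  then have "gain m J s w = 0"
    by (simp add: gain_def)
  then have zero: "0 \<in> gain m J s ` active m J"
    using w(1) by force
  have "finite J"
    using J \<open>finite F\<close> finite_subset by blast
  then have fin: "finite (gain m J s ` active m J)"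
    using finite_range_gain finite_subset[OF image_mono[OF subset_UNIV]] by blast
  show "Min (gain m J s ` active m J) \<le> 0"
    by (rule Min_le[OF fin zero])
  show "0 \<le> Max (gain m J s ` active m J)"
    by (rule Max_ge[OF fin zero])
qed

text \<open>The worlds \<open>u\<close>, \<open>v\<close>, \<open>w\<close> act as successive layers of a conditional probability: a bet has to
  be fair in the later layers only if all bets decided by an earlier layer are absent.\<close>

lemma betting_coherent_layersI:
  assumes "finite R"
    and u: "\<forall>X \<in> insert P (insert Q R). quantity_value m X u = m X" "\<not> called_off m P u"
    and v: "\<forall>X \<in> insert Q R. quantity_value m X v = m X" "\<not> called_off m Q v"
    and w: "\<forall>X \<in> R. quantity_value m X w = m X \<and> \<not> called_off m X w"
  shows "betting_coherent (insert P (insert Q R)) m"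
proof (rule betting_coherentI)
  fix J
  assume J: "J \<subseteq> insert P (insert Q R)" "J \<noteq> {}"
  consider "P \<in> J" | "P \<notin> J" "Q \<in> J" | "P \<notin> J" "Q \<notin> J"
    by blast
  then show "\<exists>w\<in>active m J. \<forall>X\<in>J. quantity_value m X w = m X"
  proof cases
    case 1
    then show ?thesis
      using J u by (intro bexI[of _ u]) (auto simp: active_def)
  next
    case 2
    then show ?thesis
      using J v by (intro bexI[of _ v]) (auto simp: active_def)
  next
    case 3
    then have "J \<subseteq> R"
      using J by blast
    then show ?thesis
      using J w by (intro bexI[of _ w]) (auto simp: active_def)
  qed
qed (use \<open>finite R\<close> in simp)

section \<open>Failure of two-premise centering\<close>

definition premises_only :: "'w quantity set \<Rightarrow> 'w quantity \<Rightarrow> real" where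
  "premises_only P X = (if X \<in> P then 1 else 0)"

text \<open>Conditional events and the iterated conditionals that are not conditional events are treated
  alike: \<open>R\<close> collects the conclusion and, in the second case, the conjunction to which coherence
  extends the family, and all of \<open>R\<close> is assessed with \<open>0\<close>.\<close>

lemma not_p_entails_if_layers:
  assumes u: "u \<in> A" "u \<in> H" "u \<notin> K"
    and v: "v \<in> B" "v \<in> K"
    and R: "finite R" "R \<inter> {Cond (A \<parallel> H), Cond (B \<parallel> K)} = {}"
    and fam: "{Cond (A \<parallel> H), Cond (B \<parallel> K)} \<union> R = insert X {Cond (A \<parallel> H), Cond (B \<parallel> K)} \<union> components X"
    and X: "X \<in> R"
    and m: "m = premises_only {Cond (A \<parallel> H), Cond (B \<parallel> K)}"
    and zero: "\<forall>Y\<in>R. quantity_value m Y u = 0 \<and> quantity_value m Y v = 0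
      \<and> quantity_value m Y w = 0 \<and> \<not> called_off m Y w"
  shows "\<not> ({Cond (A \<parallel> H), Cond (B \<parallel> K)} \<Rightarrow>\<^sub>p X)"
proof -
  let ?P = "{Cond (A \<parallel> H), Cond (B \<parallel> K)}"
  have m0: "m Y = 0" if "Y \<in> R" for Y
    using that R(2) unfolding m premises_only_def by auto
  have m1: "m (Cond (A \<parallel> H)) = 1" "m (Cond (B \<parallel> K)) = 1"
    by (simp_all add: m premises_only_def)
  have "betting_coherent (insert (Cond (A \<parallel> H)) (insert (Cond (B \<parallel> K)) R)) m"
    by (rule betting_coherent_layersI[where u = u and v = v and w = w])
      (use u v R(1) zero m0 m1 in \<open>auto simp: indicator_def\<close>)
  moreover have "insert (Cond (A \<parallel> H)) (insert (Cond (B \<parallel> K)) R)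
      = insert X ?P \<union> (\<Union>Y\<in>insert X ?P. components Y)"
    using fam by auto
  ultimately have "coherent (insert X ?P) m"
    unfolding coherent_def by metis
  moreover have "m X \<noteq> 1"
    using m0 X by simp
  ultimately show ?thesis
    using m1 unfolding p_entails_def by blast
qed

theorem mainTheorem18:
  fixes A B H K :: "'w set"
  assumes "logically_independent A B H K"
  shows "p_consistent {Cond (A \<parallel> H), Cond (B \<parallel> K)} \<and>
    (\<forall>X \<in> {Cond (iter_C (B \<parallel> K) (A \<parallel> H)),
           Cond (iter_dF (B \<parallel> K) (A \<parallel> H)),
           Cond (iter_F (B \<parallel> K) (A \<parallel> H)),
           Iter Kleene (B \<parallel> K) (A \<parallel> H),
           Iter Lukasiewicz (B \<parallel> K) (A \<parallel> H)}.
       \<not> ({Cond (A \<parallel> H), Cond (B \<parallel> K)} \<Rightarrow>\<^sub>p X))"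
proof -
  let ?P = "{Cond (A \<parallel> H), Cond (B \<parallel> K)}"
  let ?m = "premises_only ?P"
  have ne: "A \<inter> B \<inter> H \<inter> K \<noteq> {}" "A \<inter> B \<inter> H \<inter> - K \<noteq> {}"
    "- A \<inter> B \<inter> H \<inter> K \<noteq> {}" "A \<inter> - B \<inter> H \<inter> K \<noteq> {}"
    using assms unfolding logically_independent_def by simp_all
  obtain t where t: "t \<in> A" "t \<in> B" "t \<in> H" "t \<in> K"
    using ne(1) by blast
  obtain u where u: "u \<in> A" "u \<in> H" "u \<notin> K"
    using ne(2) by blast
  obtain v where v: "v \<notin> A" "v \<in> H" "v \<in> B" "v \<in> K"
    using ne(3) by blast
  obtain w where w: "w \<in> A" "w \<in> H" "w \<notin> B" "w \<in> K"
    using ne(4) by blast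
  have consistent: "p_consistent ?P"
  proof -
    have "betting_coherent ?P (\<lambda>_. 1)"
    proof (rule betting_coherentI)
      fix J
      assume J: "J \<subseteq> ?P" "J \<noteq> {}"
      have "\<forall>X\<in>?P. \<not> called_off (\<lambda>_. 1) X t"
        using t by simp
      then have "t \<in> active (\<lambda>_. 1) J"
        using J unfolding active_def by blast
      then show "\<exists>w\<in>active (\<lambda>_. 1) J. \<forall>X\<in>J. quantity_value (\<lambda>_. 1) X w = 1"
        using J t by (intro bexI[of _ t]) auto
    qed simp
    then show ?thesis
      unfolding p_consistent_def coherent_def by (intro exI[of _ "\<lambda>_. 1"]) simp
  qed
  have event: "\<not> (?P \<Rightarrow>\<^sub>p Cond (E \<parallel> G))"
    if "u \<notin> G" "v \<in> G \<longrightarrow> v \<notin> E" "w \<in> G" "w \<notin> E" for E G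
  proof -
    \<comment> \<open>A conclusion that is itself a premise could not be assessed with \<open>0\<close>. The world \<open>u\<close>
      separates \<open>E|G\<close> from \<open>A|H\<close>, and \<open>v\<close> separates it from \<open>B|K\<close>.\<close>
    have new: "Cond (E \<parallel> G) \<notin> ?P"
      using that u v w by auto
    show ?thesis
      by (rule not_p_entails_if_layers[OF u v(3,4), where R = "{Cond (E \<parallel> G)}" and w = w and m = ?m])
        (use new that in \<open>auto simp: premises_only_def indicator_def\<close>)
  qed
  have C: "\<not> (?P \<Rightarrow>\<^sub>p Cond (iter_C (B \<parallel> K) (A \<parallel> H)))"
    unfolding iter_C.simps by (rule event) (use u v w in auto)
  have dF: "\<not> (?P \<Rightarrow>\<^sub>p Cond (iter_dF (B \<parallel> K) (A \<parallel> H)))"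
    unfolding iter_dF.simps by (rule event) (use u v w in auto)
  have F: "\<not> (?P \<Rightarrow>\<^sub>p Cond (iter_F (B \<parallel> K) (A \<parallel> H)))"
    unfolding iter_F.simps by (rule event) (use u v w in auto)
  have iter: "\<not> (?P \<Rightarrow>\<^sub>p Iter i (B \<parallel> K) (A \<parallel> H))" for i
  proof -
    define Z where "Z = ce_conj i (A \<parallel> H) (B \<parallel> K)"
    obtain E G where EG: "Z = E \<parallel> G"
      by (cases Z)
    have Z: "u \<notin> G" "v \<in> G" "v \<notin> E" "w \<in> G" "w \<notin> E"
      using EG u v w unfolding Z_def by (cases i; auto)+
    have new: "Cond Z \<notin> ?P"
      using EG Z u v w by auto
    have m: "?m (Cond (A \<parallel> H)) = 1" "?m (Cond Z) = 0" "?m (Iter i (B \<parallel> K) (A \<parallel> H)) = 0"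
      using new by (simp_all add: premises_only_def)
    have val: "quantity_value ?m Y x = 0"
      if "Y \<in> {Cond Z, Iter i (B \<parallel> K) (A \<parallel> H)}" "x \<in> {u, v, w}" for Y x
      using that m Z unfolding Z_def[symmetric] EG
      by (auto simp: iter_value_def Z_def[symmetric] EG)
    \<comment> \<open>In \<open>w\<close> the antecedent is true and the conjunction false, so the amount received is \<open>0\<close>
      whatever amount is paid.\<close>
    have "iter_value i (B \<parallel> K) (A \<parallel> H) 1 1 1 w \<noteq> 1"
      using Z w by (simp add: iter_value_def Z_def[symmetric] EG)
    then have off: "\<not> called_off ?m (Iter i (B \<parallel> K) (A \<parallel> H)) w"
      using m(1) by (auto intro!: exI[of _ 1])
    show ?thesis
    proof (rule not_p_entails_if_layers[OF u v(3,4),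
          where R = "{Cond Z, Iter i (B \<parallel> K) (A \<parallel> H)}" and w = w and m = ?m])
      show "\<forall>Y\<in>{Cond Z, Iter i (B \<parallel> K) (A \<parallel> H)}. quantity_value ?m Y u = 0
          \<and> quantity_value ?m Y v = 0 \<and> quantity_value ?m Y w = 0 \<and> \<not> called_off ?m Y w"
        using val off Z EG by auto
    qed (use new in \<open>auto simp: Z_def\<close>)
  qed
  show ?thesis
    using consistent C dF F iter by simp
qed

end
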